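(* Let $\mathbf{F}\colon \mathbf{Met}\to\mathbf{Cov}_{f\ell}$ be a non-trivial clustering functor with clustering parameter $\delta_{\mathbf{F}}$, and assume that $\mathbf{F}(\Lambda^1_{\delta_{\mathbf{F}}})$ is a single two-point cluster. Then for every finite metric space $(X,d_X)$, the flag cover of $X$ output by $\mathbf{F}(X,d_X)$ refines the cover output by $\mathbf{SL}_{\delta_{\mathbf{F}}}(X,d_X)$ and is refined by the cover output by $\mathbf{ML}_{\delta_{\mathbf{F}}}(X,d_X)$.
   Context: Covers: a cover of a set $X$ is a collection of subsets of $X$ with union $X$; a cover $\mathcal{C}_1$ refines a cover $\mathcal{C}_2$ if every $U\in\mathcal{C}_1$ is contained in some $V\in\mathcal{C}_2$. For a map $f\colon X\to Y$ and a cover $\mathcal{D}$ of $Y$, $f^{-1}(\mathcal{D})=\{f^{-1}(V) : V\in\mathcal{D}\}$. Flag covers: a (non-nested) flag cover of a non-empty finite set $X$ is a cover $\mathcal{C}$ of $X$ such that (1) if $A,B\in\mathcal{C}$ and $A\subseteq B$ then $A=B$; and (2) the abstract simplicial complex of all subsets of elements of $\mathcal{C}$ is a flag complex, i.e. a subset $S\subseteq X$ is contained in some element of $\mathcal{C}$ whenever every pair of distinct points of $S$ is contained in some element of $\mathcal{C}$. Categories: $\mathbf{Met}$ has as objects the finite (non-empty) metric spaces, where zero distances between distinct points are allowed (i.e. finite pseudometric spaces), and as morphisms the non-expansive maps, $d_Y(f(x),f(x'))\le d_X(x,x')$. $\mathbf{Cov}_{f\ell}$ has as objects pairs $(X,\mathcal{C})$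 with $\mathcal{C}$ a flag cover of the non-empty finite set $X$; a morphism $(X,\mathcal{C})\to(Y,\mathcal{D})$ is a map of sets $f\colon X\to Y$ such that $\mathcal{C}$ refines $f^{-1}(\mathcal{D})$. Clustering functors: a clustering functor is a covariant functor $\mathbf{F}\colon\mathbf{Met}\to\mathbf{Cov}_{f\ell}$ which is the identity on underlying sets and underlying set maps, so $\mathbf{F}(X,d_X)=(X,\mathcal{C})$ for some flag cover $\mathcal{C}$ of $X$. For $\varepsilon\ge 0$, $\Lambda^1_\varepsilon$ is the two-point space $\{0,1\}$ with distance $\varepsilon$ between the two points. $\mathbf{F}$ is trivial if $\mathbf{F}(\Lambda^1_\varepsilon)$ consists of two singleton clusters for all $\varepsilon\ge0$, or $\mathbf{F}(\Lambda^1_\varepsilon)$ is a single two-point cluster for all $\varepsilon\ge 0$; otherwise $\mathbf{F}$ is non-trivial. If $\mathbf{F}$ is non-trivial, its clustering parameter is the number $\delta_{\mathbf{F}}\ge0$ such that $\mathbf{F}(\Lambda^1_\varepsilon)$ is a single two-point cluster if $\varepsilon<\delta_{\mathbf{F}}$ and consists of two singleton clusters if $\varepsilon>\delta_{\mathbf{F}}$. For $\delta\ge 0$: $\mathbf{SL}_\delta(X,d_X)$ (single linkage) is $X$ with the partition into equivalence classes of the relation $x\sim_\delta y$ iff there is a finite sequence $x=x_0,x_1,\dots,x_k=y$ in $X$ with $d_X(x_{i-1},x_i)\le\delta$ for all $1\le i\le k$. $\mathbf{ML}_\delta(X,d_X)$ (maximal linkage) is $X$ with the cover by all subsets $S\subseteq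 X$ that are maximal under inclusion with respect to the property $d_X(x,y)\le\delta$ for all $x,y\in S$ (the maximal simplices of the Vietoris--Rips complex at scale $\delta$). *)

theory Defs
  imports Complex_Main "HOL-Library.FuncSet"
begin

text \<open>
  A finite space is a carrier set together with a total distance function, of which only the
  values on the carrier are constrained. The carriers range over the finite subsets of a type
  \<open>'a\<close>, which plays the role of the universe of points.
\<close>

definition finite_pseudometric :: "'a set \<Rightarrow> ('a \<Rightarrow> 'a \<Rightarrow> real) \<Rightarrow> bool" where
  "finite_pseudometric X d \<longleftrightarrow>
     finite X \<and> X \<noteq> {} \<and>
     (\<forall>x\<in>X. \<forall>y\<in>X. d x y \<ge> 0) \<and>
     (\<forall>x\<in>X. d x x = 0) \<and>
     (\<forall>x\<in>X. \<forall>y\<in>X. d x y = d y x) \<and>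
     (\<forall>x\<in>X. \<forall>y\<in>X. \<forall>z\<in>X. d x z \<le> d x y + d y z)"

definition nonexpansive ::
  "'a set \<Rightarrow> ('a \<Rightarrow> 'a \<Rightarrow> real) \<Rightarrow> 'b set \<Rightarrow> ('b \<Rightarrow> 'b \<Rightarrow> real) \<Rightarrow> ('a \<Rightarrow> 'b) \<Rightarrow> bool" where
  "nonexpansive X dX Y dY f \<longleftrightarrow>
     f \<in> X \<rightarrow> Y \<and> (\<forall>x\<in>X. \<forall>x'\<in>X. dY (f x) (f x') \<le> dX x x')"

definition cover :: "'a set \<Rightarrow> 'a set set \<Rightarrow> bool" where
  "cover X C \<longleftrightarrow> (\<forall>U\<in>C. U \<subseteq> X) \<and> \<Union>C = X"

definition refines :: "'a set set \<Rightarrow> 'a set set \<Rightarrow> bool" where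
  "refines C1 C2 \<longleftrightarrow> (\<forall>U\<in>C1. \<exists>V\<in>C2. U \<subseteq> V)"

definition preimage_cover :: "'a set \<Rightarrow> ('a \<Rightarrow> 'b) \<Rightarrow> 'b set set \<Rightarrow> 'a set set" where
  "preimage_cover X f D = (\<lambda>V. f -` V \<inter> X) ` D"

definition flag_cover :: "'a set \<Rightarrow> 'a set set \<Rightarrow> bool" where
  "flag_cover X C \<longleftrightarrow>
     finite X \<and> X \<noteq> {} \<and> cover X C \<and>
     (\<forall>A\<in>C. \<forall>B\<in>C. A \<subseteq> B \<longrightarrow> A = B) \<and>
     (\<forall>S. S \<subseteq> X \<and> (\<forall>x\<in>S. \<forall>y\<in>S. x \<noteq> y \<longrightarrow> (\<exists>A\<in>C. {x, y} \<subseteq> A)) \<longrightarrow> (\<exists>A\<in>C. S \<subseteq> A))"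

definition cover_morphism ::
  "'a set \<Rightarrow> 'a set set \<Rightarrow> 'b set \<Rightarrow> 'b set set \<Rightarrow> ('a \<Rightarrow> 'b) \<Rightarrow> bool" where
  "cover_morphism X C Y D f \<longleftrightarrow> f \<in> X \<rightarrow> Y \<and> refines C (preimage_cover X f D)"

text \<open>
  A clustering functor leaves underlying sets and maps unchanged, so it is determined by the cover
  \<open>F X d\<close> it assigns to each space, preservation of identities and composition is automatic, and
  functoriality says exactly that every morphism of spaces is a morphism of the assigned covers.
  Applied to the identity map and two distance functions agreeing on \<open>X\<close>, this also forces
  \<open>F X d\<close> to depend only on the restriction of \<open>d\<close> to \<open>X\<close>.
\<close>

type_synonym 'a clustering = "'a set \<Rightarrow> ('a \<Rightarrow> 'a \<Rightarrow> real) \<Rightarrow> 'a set set"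

definition clustering_functor :: "'a clustering \<Rightarrow> bool" where
  "clustering_functor F \<longleftrightarrow>
     (\<forall>X d. finite_pseudometric X d \<longrightarrow> flag_cover X (F X d)) \<and>
     (\<forall>X dX Y dY f.
        finite_pseudometric X dX \<and> finite_pseudometric Y dY \<and> nonexpansive X dX Y dY f \<longrightarrow>
        cover_morphism X (F X dX) Y (F Y dY) f)"

text \<open>
  The two-point space of diameter \<open>\<epsilon>\<close> has carrier \<open>{p, q}\<close>, where \<open>p \<noteq> q\<close> are two points of the
  universe standing for 0 and 1. By functoriality the choice of \<open>p\<close> and \<open>q\<close> is immaterial.
\<close>

definition two_point_dist :: "real \<Rightarrow> 'a \<Rightarrow> 'a \<Rightarrow> real" where
  "two_point_dist \<epsilon> x y = (if x = y then 0 else \<epsilon>)"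

definition joins_two_points :: "'a \<Rightarrow> 'a \<Rightarrow> 'a clustering \<Rightarrow> real \<Rightarrow> bool" where
  "joins_two_points p q F \<epsilon> \<longleftrightarrow> F {p, q} (two_point_dist \<epsilon>) = {{p, q}}"

definition separates_two_points :: "'a \<Rightarrow> 'a \<Rightarrow> 'a clustering \<Rightarrow> real \<Rightarrow> bool" where
  "separates_two_points p q F \<epsilon> \<longleftrightarrow> F {p, q} (two_point_dist \<epsilon>) = {{p}, {q}}"

definition trivial_clustering :: "'a \<Rightarrow> 'a \<Rightarrow> 'a clustering \<Rightarrow> bool" where
  "trivial_clustering p q F \<longleftrightarrow>
     (\<forall>\<epsilon>\<ge>0. separates_two_points p q F \<epsilon>) \<or> (\<forall>\<epsilon>\<ge>0. joins_two_points p q F \<epsilon>)"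

text \<open>
  The number described below exists and is unique for every non-trivial clustering functor.
\<close>

definition clustering_parameter :: "'a \<Rightarrow> 'a \<Rightarrow> 'a clustering \<Rightarrow> real" where
  "clustering_parameter p q F =
     (THE \<delta>. \<delta> \<ge> 0 \<and>
        (\<forall>\<epsilon>\<ge>0. (\<epsilon> < \<delta> \<longrightarrow> joins_two_points p q F \<epsilon>) \<and>
               (\<epsilon> > \<delta> \<longrightarrow> separates_two_points p q F \<epsilon>)))"

definition chain_rel :: "real \<Rightarrow> 'a set \<Rightarrow> ('a \<Rightarrow> 'a \<Rightarrow> real) \<Rightarrow> ('a \<times> 'a) set" where
  "chain_rel \<delta> X d =
     {(x, y). \<exists>(k::nat) (z::nat \<Rightarrow> 'a). z 0 = x \<and> z k = y \<and> (\<forall>i\<le>k. z i \<in> X) \<and>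
        (\<forall>i\<in>{1..k}. d (z (i - 1)) (z i) \<le> \<delta>)}"

definition single_linkage :: "real \<Rightarrow> 'a clustering" where
  "single_linkage \<delta> X d = X // chain_rel \<delta> X d"

definition maximal_linkage :: "real \<Rightarrow> 'a clustering" where
  "maximal_linkage \<delta> X d =
     {S. S \<subseteq> X \<and> (\<forall>x\<in>S. \<forall>y\<in>S. d x y \<le> \<delta>) \<and>
         (\<forall>T. T \<subseteq> X \<and> (\<forall>x\<in>T. \<forall>y\<in>T. d x y \<le> \<delta>) \<and> S \<subseteq> T \<longrightarrow> T = S)}"

end

theory Submission
  imports Defs
begin

text \<open>
  Write \<open>\<delta>\<close> for the clustering parameter. Two points at distance at most \<open>\<delta>\<close> are the image of the
  joined space \<open>\<Lambda>\<^sub>\<delta>\<close>, so they share a cluster of \<open>F X d\<close>; by the flag condition every set of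
  diameter at most \<open>\<delta>\<close> then lies in a cluster. Conversely, a single linkage class \<open>A\<close> has some
  distance \<open>\<epsilon> > \<delta>\<close> from its complement, so the map to \<open>\<Lambda>\<^sub>\<epsilon>\<close> collapsing \<open>A\<close> and its complement to
  one point each is non-expansive; since \<open>\<Lambda>\<^sub>\<epsilon>\<close> is separated, no cluster meets both.
\<close>

text \<open>If \<open>{p, q}\<close> is a cluster, the antichain condition absorbs every other
  cluster into it. Otherwise clusters have at most one point, covering forces both singletons in,
  and the antichain condition excludes the empty set.\<close>

lemma flag_cover_doubleton:
  assumes "flag_cover {p, q} C"
  shows "C = {{p, q}} \<or> C = {{p}, {q}}"
proof -
  have un: "\<Union>C = {p, q}" and anti: "\<And>A B. A \<in> C \<Longrightarrow> B \<in> C \<Longrightarrow> A \<subseteq> B \<Longrightarrow> A = B"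
    using assms unfolding flag_cover_def cover_def by simp_all
  have sub: "A \<subseteq> {p, q}" if "A \<in> C" for A
    using Union_upper[OF that] un by simp
  show ?thesis
  proof (cases "{p, q} \<in> C")
    case True
    then have "C \<subseteq> {{p, q}}"
      using anti sub by (metis singletonI subsetI)
    then show ?thesis
      using True by (intro disjI1 equalityI) simp_all
  next
    case False
    then have sub': "A = {} \<or> A = {p} \<or> A = {q}" if "A \<in> C" for A
      using PowI[OF sub[OF that]] that by (auto simp only: Pow_insert Pow_empty)
    have mem: "{x} \<in> C" if x: "x \<in> {p, q}" for x
    proof -
      obtain A where "A \<in> C" "x \<in> A"
        using x un by (metis UnionE)
      then show ?thesis
        using sub'[of A] by auto
    qed
    then have "{} \<notin> C"
      using anti[of "{}" "{p}"] by auto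
    then have "C \<subseteq> {{p}, {q}}"
      using sub' by (intro subsetI) (simp only: insert_iff, metis)
    moreover have "{{p}, {q}} \<subseteq> C"
      using mem by simp
    ultimately show ?thesis
      by (intro disjI2 equalityI)
  qed
qed

lemma finite_pseudometric_two_point:
  assumes "\<epsilon> \<ge> 0"
  shows "finite_pseudometric {p, q} (two_point_dist \<epsilon>)"
  using assms unfolding finite_pseudometric_def two_point_dist_def by auto

lemma joins_not_separates:
  assumes "p \<noteq> q" "joins_two_points p q F \<epsilon>"
  shows "\<not> separates_two_points p q F \<epsilon>"
  using assms unfolding joins_two_points_def separates_two_points_def by blast

lemma clustering_functor_flag_cover:
  assumes "clustering_functor F" "finite_pseudometric X d"
  shows "flag_cover X (F X d)"
  using assms unfolding clustering_functor_def by blast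

lemma joins_or_separates:
  assumes "clustering_functor F" "\<epsilon> \<ge> 0"
  shows "joins_two_points p q F \<epsilon> \<or> separates_two_points p q F \<epsilon>"
  unfolding joins_two_points_def separates_two_points_def
  using assms
  by (intro flag_cover_doubleton clustering_functor_flag_cover finite_pseudometric_two_point)

text \<open>Functoriality rephrased with images instead of preimage covers, ready to be applied to
  an explicitly chosen map.\<close>

lemma clustering_functor_image_subset:
  assumes "clustering_functor F" "finite_pseudometric X dX" "finite_pseudometric Y dY"
    and "nonexpansive X dX Y dY f" "U \<in> F X dX"
  obtains V where "V \<in> F Y dY" "f ` U \<subseteq> V"
proof -
  have "cover_morphism X (F X dX) Y (F Y dY) f"
    using assms unfolding clustering_functor_def by blast
  then obtain V where "V \<in> F Y dY" "U \<subseteq> f -` V \<inter> X"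
    using assms(5) unfolding cover_morphism_def refines_def preimage_cover_def by blast
  then show thesis
    using that by blast
qed

text \<open>The identity from scale \<open>\<epsilon>'\<close> down to \<open>\<epsilon>\<close> is
  non-expansive, so the two-point cluster must stay inside one cluster.\<close>

lemma joins_antimono:
  assumes "clustering_functor F" "p \<noteq> q"
    and "joins_two_points p q F \<epsilon>'" "0 \<le> \<epsilon>" "\<epsilon> \<le> \<epsilon>'"
  shows "joins_two_points p q F \<epsilon>"
proof -
  have "nonexpansive {p, q} (two_point_dist \<epsilon>') {p, q} (two_point_dist \<epsilon>) id"
    using assms unfolding nonexpansive_def two_point_dist_def by auto
  moreover have "{p, q} \<in> F {p, q} (two_point_dist \<epsilon>')"
    using assms unfolding joins_two_points_def by simp
  ultimately obtain V where "V \<in> F {p, q} (two_point_dist \<epsilon>)" "id ` {p, q} \<subseteq> V"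
    by (rule clustering_functor_image_subset[OF assms(1)
          finite_pseudometric_two_point[OF order_trans[OF assms(4,5)]]
          finite_pseudometric_two_point[OF assms(4)]])
  then have "\<not> separates_two_points p q F \<epsilon>"
    using \<open>p \<noteq> q\<close> unfolding separates_two_points_def by auto
  then show ?thesis
    using joins_or_separates[OF assms(1,4)] by blast
qed

text \<open>The definite description has to be justified first: the supremum of the joined scales is
  a witness, and it is the only one.\<close>

lemma clustering_parameter_spec:
  assumes "p \<noteq> q" "clustering_functor F" "\<not> trivial_clustering p q F"
  shows "clustering_parameter p q F \<ge> 0"
    and "\<epsilon> > clustering_parameter p q F \<Longrightarrow> separates_two_points p q F \<epsilon>"
proof -
  define P where "P \<delta> \<longleftrightarrow> \<delta> \<ge> 0 \<and>
        (\<forall>\<epsilon>\<ge>0. (\<epsilon> < \<delta> \<longrightarrow> joins_two_points p q F \<epsilon>) \<and>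
               (\<epsilon> > \<delta> \<longrightarrow> separates_two_points p q F \<epsilon>))" for \<delta> :: real
  define J where "J = {\<epsilon>. \<epsilon> \<ge> 0 \<and> joins_two_points p q F \<epsilon>}"
  \<comment> \<open>Each half of non-triviality serves once: some scale is not separated, so
    \<open>J\<close> is non-empty, and some scale is not joined, which bounds \<open>J\<close> by
    monotonicity.\<close>
  obtain a where a: "a \<in> J"
    using assms(3) joins_or_separates[OF assms(2)] unfolding trivial_clustering_def J_def
    by blast
  obtain b where b: "b \<ge> 0" "\<not> joins_two_points p q F b"
    using assms unfolding trivial_clustering_def by blast
  have "x \<le> b" if "x \<in> J" for x
    using that b joins_antimono[OF assms(2,1)] unfolding J_def by force
  then have bdd: "bdd_above J"
    by (rule bdd_aboveI)
  have "P (Sup J)"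
    unfolding P_def
  proof (intro conjI allI impI)
    show "0 \<le> Sup J"
      using a cSup_upper[OF a bdd] unfolding J_def by simp
  next
    fix \<epsilon> :: real
    assume "0 \<le> \<epsilon>" "\<epsilon> < Sup J"
    then obtain x where "x \<in> J" "\<epsilon> < x"
      using less_cSupE a by (metis empty_iff)
    then show "joins_two_points p q F \<epsilon>"
      using joins_antimono[OF assms(2,1)] \<open>0 \<le> \<epsilon>\<close> unfolding J_def by force
  next
    fix \<epsilon> :: real
    assume "0 \<le> \<epsilon>" "Sup J < \<epsilon>"
    then have "\<epsilon> \<notin> J"
      using cSup_upper[OF _ bdd] by force
    then show "separates_two_points p q F \<epsilon>"
      using joins_or_separates[OF assms(2) \<open>0 \<le> \<epsilon>\<close>] \<open>0 \<le> \<epsilon>\<close> unfolding J_def by blast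
  qed
  \<comment> \<open>A scale strictly between two candidates would be joined because of the larger
    and separated because of the smaller.\<close>
  moreover have "\<not> x < y" if "P x" "P y" for x y
  proof
    assume "x < y"
    then obtain z where "x < z" "z < y"
      using dense by blast
    then have "joins_two_points p q F z" "separates_two_points p q F z"
      using that unfolding P_def by auto
    then show False
      using joins_not_separates[OF assms(1)] by blast
  qed
  ultimately have "\<exists>!\<delta>. P \<delta>"
    by (metis linorder_neqE)
  then have "P (THE \<delta>. P \<delta>)"
    by (rule theI')
  then have *: "P (clustering_parameter p q F)"
    unfolding clustering_parameter_def P_def .
  then show "clustering_parameter p q F \<ge> 0"
    unfolding P_def by blast
  show "separates_two_points p q F \<epsilon>" if "\<epsilon> > clustering_parameter p q F"
    using * that unfolding P_def by auto
qed

text \<open>Points of \<open>S\<close> may be at distance exactly \<delta>, so joining is required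
  at the critical scale itself and not merely below it.\<close>

lemma maximal_linkage_refines:
  assumes "p \<noteq> q" "clustering_functor F" "finite_pseudometric X d"
    and "\<delta> \<ge> 0" "joins_two_points p q F \<delta>"
  shows "refines (maximal_linkage \<delta> X d) (F X d)"
  unfolding refines_def
proof
  fix S
  assume "S \<in> maximal_linkage \<delta> X d"
  then have S: "S \<subseteq> X" "\<And>x y. x \<in> S \<Longrightarrow> y \<in> S \<Longrightarrow> d x y \<le> \<delta>"
    unfolding maximal_linkage_def by auto
  have "\<exists>A\<in>F X d. {x, y} \<subseteq> A" if "x \<in> S" "y \<in> S" for x y
  proof -
    let ?f = "\<lambda>z. if z = p then x else y"
    have "nonexpansive {p, q} (two_point_dist \<delta>) X d ?f"
      using that S assms unfolding nonexpansive_def two_point_dist_def finite_pseudometric_def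
      by auto
    moreover have "{p, q} \<in> F {p, q} (two_point_dist \<delta>)"
      using assms unfolding joins_two_points_def by simp
    ultimately obtain A where "A \<in> F X d" "?f ` {p, q} \<subseteq> A"
      by (rule clustering_functor_image_subset[OF assms(2)
            finite_pseudometric_two_point[OF assms(4)] assms(3)])
    then show ?thesis
      using \<open>p \<noteq> q\<close> by auto
  qed
  \<comment> \<open>The flag condition merges the clusters found for single pairs into one
    containing all of \<open>S\<close>.\<close>
  then show "\<exists>A\<in>F X d. S \<subseteq> A"
    using clustering_functor_flag_cover[OF assms(2,3)] S(1) unfolding flag_cover_def by simp
qed

lemma chain_rel_refl:
  assumes "x \<in> X"
  shows "(x, x) \<in> chain_rel \<delta> X d"
  using assms unfolding chain_rel_def by (auto intro!: exI[of _ 0] exI[of _ "\<lambda>_. x"])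

lemma chain_rel_extend:
  assumes "(x, a) \<in> chain_rel \<delta> X d" "b \<in> X" "d a b \<le> \<delta>"
  shows "(x, b) \<in> chain_rel \<delta> X d"
proof -
  obtain k :: nat and z where z: "z 0 = x" "z k = a" "\<forall>i\<le>k. z i \<in> X"
    "\<forall>i\<in>{1..k}. d (z (i - 1)) (z i) \<le> \<delta>"
    using assms(1) unfolding chain_rel_def by blast
  show ?thesis
    unfolding chain_rel_def
    \<comment> \<open>The chain is lengthened by one step, with \<open>b\<close> appended after its
      last point \<open>a\<close>.\<close>
    by (rule CollectI, rule case_prodI, rule exI[of _ "Suc k"], rule exI[of _ "z(Suc k := b)"])
      (use z assms in \<open>auto simp: le_Suc_eq\<close>)
qed

text \<open>A point outside the class within \<delta> of a point of the class would extend a chain.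
  Finiteness of \<open>X\<close> turns these strict inequalities into a uniform gap.\<close>

lemma single_linkage_separation:
  assumes "finite_pseudometric X d" "A = chain_rel \<delta> X d `` {x}"
  obtains \<epsilon> where "\<epsilon> > \<delta>" "\<And>a b. a \<in> A \<inter> X \<Longrightarrow> b \<in> X - A \<Longrightarrow> \<epsilon> \<le> d a b"
proof -
  \<comment> \<open>The extra value \<open>\<delta> + 1\<close> keeps \<open>D\<close> non-empty
    when the class is all of \<open>X\<close>.\<close>
  define D where "D = insert (\<delta> + 1) ((\<lambda>(a, b). d a b) ` ((A \<inter> X) \<times> (X - A)))"
  have "finite D"
    using assms(1) unfolding D_def finite_pseudometric_def by simp
  have "\<delta> < d a b" if "a \<in> A" "b \<in> X - A" for a b
    using chain_rel_extend[of x a \<delta> X d b] that assms(2) by force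
  then have "\<forall>t\<in>D. \<delta> < t"
    unfolding D_def by auto
  then have "\<delta> < Min D"
    using \<open>finite D\<close> unfolding D_def by simp
  moreover have "Min D \<le> d a b" if "a \<in> A \<inter> X" "b \<in> X - A" for a b
    using \<open>finite D\<close> that by (intro Min_le) (auto simp: D_def)
  ultimately show thesis
    using that by blast
qed

text \<open>Separation is assumed at every scale above \<delta> because the gap around a class
  depends on the space and on the class.\<close>

lemma refines_single_linkage:
  assumes "p \<noteq> q" "clustering_functor F" "finite_pseudometric X d"
    and "\<delta> \<ge> 0" and sep: "\<And>\<epsilon>. \<epsilon> > \<delta> \<Longrightarrow> separates_two_points p q F \<epsilon>"
  shows "refines (F X d) (single_linkage \<delta> X d)"
  unfolding refines_def
proof
  fix U
  assume U: "U \<in> F X d"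
  have "X \<noteq> {}" and UX: "U \<subseteq> X"
    using clustering_functor_flag_cover[OF assms(2,3)] U
    unfolding flag_cover_def cover_def by auto
  \<comment> \<open>This choice also handles an empty \<open>U\<close>, for which any class will
    do.\<close>
  then obtain x where x: "x \<in> X" "U \<noteq> {} \<Longrightarrow> x \<in> U"
    by blast
  define A where "A = chain_rel \<delta> X d `` {x}"
  have "x \<in> A"
    using chain_rel_refl x unfolding A_def by fast
  obtain \<epsilon> where \<epsilon>: "\<epsilon> > \<delta>" "\<And>a b. a \<in> A \<inter> X \<Longrightarrow> b \<in> X - A \<Longrightarrow> \<epsilon> \<le> d a b"
    using single_linkage_separation[OF assms(3) A_def] by blast
  let ?f = "\<lambda>z. if z \<in> A then p else q"
  have "nonexpansive X d {p, q} (two_point_dist \<epsilon>) ?f"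
    unfolding nonexpansive_def
  proof (intro conjI ballI)
    fix a b
    assume "a \<in> X" "b \<in> X"
    moreover from this have "d a b = d b a" "d a b \<ge> 0"
      using assms(3) unfolding finite_pseudometric_def by blast+
    ultimately show "two_point_dist \<epsilon> (?f a) (?f b) \<le> d a b"
      using \<epsilon>(2)[of a b] \<epsilon>(2)[of b a] unfolding two_point_dist_def by auto
  qed auto
  moreover have "finite_pseudometric {p, q} (two_point_dist \<epsilon>)"
    using \<epsilon>(1) assms(4) by (simp add: finite_pseudometric_two_point)
  ultimately obtain V where V: "V \<in> F {p, q} (two_point_dist \<epsilon>)" "?f ` U \<subseteq> V"
    using clustering_functor_image_subset[OF assms(2,3) _ _ U] by metis
  then have "V = {p} \<or> V = {q}"
    using sep[OF \<epsilon>(1)] unfolding separates_two_points_def by simp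
  \<comment> \<open>If \<open>U\<close> is non-empty, it contains \<open>x\<close>, which maps to
    \<open>p\<close>. Hence \<open>V\<close> is \<open>{p}\<close> and all of \<open>U\<close> maps
    to \<open>p\<close>.\<close>
  then have "U \<subseteq> A"
    using V(2) x(2) \<open>x \<in> A\<close> \<open>p \<noteq> q\<close> by (fastforce split: if_splits)
  moreover have "A \<in> single_linkage \<delta> X d"
    using x(1) unfolding single_linkage_def A_def by (rule quotientI)
  ultimately show "\<exists>V\<in>single_linkage \<delta> X d. U \<subseteq> V"
    by blast
qed

theorem theorem8:
  fixes F :: "'a clustering" and p q :: 'a
  assumes "p \<noteq> q"
    and "clustering_functor F"
    and "\<not> trivial_clustering p q F"
    and "joins_two_points p q F (clustering_parameter p q F)"
  shows "\<forall>X d. finite_pseudometric X d \<longrightarrow>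
           refines (F X d) (single_linkage (clustering_parameter p q F) X d) \<and>
           refines (maximal_linkage (clustering_parameter p q F) X d) (F X d)"
  using assms clustering_parameter_spec[OF assms(1-3)]
  by (blast intro: refines_single_linkage maximal_linkage_refines)

end
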